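(* Let $\mathsf{mapL}$ be the Cedille term of type $\forall A{:}\star.\ \forall B{:}\star.\ \Pi f{:}A\to B.\ \mathsf{List}\cdot A\to\mathsf{List}\cdot B$ (map for inductive lists) defined in the context. Then the partial application of its erasure to the identity is the identity function: $|\mathsf{mapL}|\ (\lambda x.\,x) =_{\alpha\beta\eta}\lambda x.\,x$.
   Context: **Terms and erasure.** Terms are those of Cedille (type theory $\iota\lambda P2$), a type-annotated Curry-style dependent type theory. $\star$ is the kind of types; $\lambda x.\,t$ and $t\ t'$ are explicit abstraction and application (types $\Pi x{:}T.\,T'$, or $T\to T'$); $\Lambda x.\,t$ is implicit (erased) abstraction over a value or a type (types $\forall x{:}T.\,T'$, or $T\Rightarrow T'$ if non-dependent), with implicit value application $t\ {-}t'$ and type application $t\cdot T$; $[t,t']$, $t.1$, $t.2$ are the introduction and projections of the dependent intersection type $\iota x{:}T.\,T'$; $\beta$ and $\beta\{t\}$ are reflexivity proofs of the heterogeneous equality type $t_1\simeq t_2$; $\rho\ q - t$ is $t$ with its type rewritten by the equality proof $q$. Erasure $|\cdot|$ maps annotated terms to untyped $\lambda$-terms: $|x|=x$, $|\lambda x.t|=\lambda x.|t|$, $|t\ t'|=|t|\ |t'|$, $|\Lambda x.t|=|t|$, $|t\ {-}t'|=|t|$, $|t\cdot T|=|t|$, $|[t,t']|=|t|$, $|t.1|=|t.2|=|t|$, $|\beta\{t\}|=|t|$, $|\beta|=\lambda x.x$, $|\rho\ q - t|=|t|$. Defined constants are unfolded. Erased terms are compared up to $\alpha\beta\eta$-equality.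 Type information does not affect erasure. **Lists.** $\mathsf{ListC}\cdot A=\forall X{:}\star.\ X\to(A\to X\to X)\to X$; $\mathsf{nilCL}=\Lambda A,X.\lambda c_N,c_C.\,c_N$; $\mathsf{consCL}=\Lambda A.\lambda x,xs.\Lambda X.\lambda c_N,c_C.\ c_C\ x\ (xs\cdot X\ c_N\ c_C)$; $\mathsf{ListP}\cdot A\ xsC=\forall X{:}\star.\forall P{:}X\to\star.\forall c_N{:}X.\forall c_C{:}A\to X\to X.\ P\ c_N\to(\forall xs{:}X.\Pi x{:}A.\ P\ xs\to P(c_C\ x\ xs))\to P(xsC\cdot X\ c_N\ c_C)$; $\mathsf{ListR}\cdot A\ xsC=(xsC\cdot(\mathsf{ListC}\cdot A)\ \mathsf{nilCL}\ \mathsf{consCL}\simeq xsC)$; $\mathsf{List}\cdot A=\iota xs{:}(\iota xsC{:}\mathsf{ListC}\cdot A.\ \mathsf{ListP}\cdot A\ xsC).\ \mathsf{ListR}\cdot A\ xs.1$. Helper: $\mathsf{mkList}:\forall A{:}\star.\Pi xs{:}(\iota xsC{:}\mathsf{ListC}\cdot A.\mathsf{ListP}\cdot A\ xsC).\ \mathsf{ListR}\cdot A\ xs.1\Rightarrow\mathsf{List}\cdot A$ is $\Lambda A.\lambda xs.\Lambda q.\,[xs,\ \rho\ q-\beta\{xs\}]$. **Map.** $\mathsf{mapCL}:\forall A.\forall B.\Pi f{:}A\to B.\ \mathsf{List}\cdot A\to\mathsf{ListC}\cdot B$ is $\Lambda A.\Lambda B.\lambda f.\lambda xs.\Lambda X.\lambda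 c_N.\lambda c_C.\ xs.1.1\cdot X\ c_N\ (\lambda x.\ c_C\ (f\ x))$. $\mathsf{mapPL}:\forall A.\forall B.\Pi f{:}A\to B.\Pi xs{:}\mathsf{List}\cdot A.\ \mathsf{ListP}\cdot B\ (\mathsf{mapCL}\cdot A\cdot B\ f\ xs)$ is $\Lambda A.\Lambda B.\lambda f.\lambda xs.\Lambda X.\Lambda P.\Lambda c_N.\Lambda c_C.\lambda p_N.\lambda p_C.\ xs.1.2\cdot X\cdot P\ {-}c_N\ {-}(\lambda x.\ c_C\ (f\ x))\ p_N\ (\Lambda xsC.\lambda x.\ p_C\ {-}xsC\ (f\ x))$. $\mathsf{mapRL}$ is a proof (by induction on the list) of $\forall A.\forall B.\Pi f{:}A\to B.\Pi xs{:}\mathsf{List}\cdot A.\ \mathsf{ListR}\cdot B\ (\mathsf{mapCL}\cdot A\cdot B\ f\ xs)$; it is used only in an erased position. $\mathsf{mapL}=\Lambda A.\Lambda B.\lambda f.\lambda xs.\ \mathsf{mkList}\cdot B\ [\mathsf{mapCL}\cdot A\cdot B\ f\ xs,\ \mathsf{mapPL}\cdot A\cdot B\ f\ xs]\ {-}(\mathsf{mapRL}\cdot A\cdot B\ f\ xs)$. *)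

theory Defs
  imports Main
begin

section \<open>Untyped \<lambda>-terms up to \<alpha>\<beta>\<eta>-equality\<close>

type_synonym name = string

datatype lam =
    LVar name
  | LLam name lam (\<open>(\<open>open_block notation=\<open>binder LAM\<close>\<close>LAM _./ _)\<close> [100, 10] 10)
  | LApp lam lam  (infixl \<open>$\<close> 200)

primrec fv :: "lam \<Rightarrow> name set" where
  "fv (LVar x) = {x}"
| "fv (LAM x. t) = fv t - {x}"
| "fv (t $ u) = fv t \<union> fv u"

primrec bv :: "lam \<Rightarrow> name set" where
  "bv (LVar x) = {}"
| "bv (LAM x. t) = insert x (bv t)"
| "bv (t $ u) = bv t \<union> bv u"

text \<open>Substitution of \<open>s\<close> for the free occurrences of \<open>x\<close>, without renaming of bound
  variables. It is capture-avoiding whenever no free variable of \<open>s\<close> is bound in the term, and it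
  is only used under that condition below.\<close>

primrec subst :: "name \<Rightarrow> lam \<Rightarrow> lam \<Rightarrow> lam" where
  "subst x s (LVar y) = (if y = x then s else LVar y)"
| "subst x s (LAM y. t) = (if y = x then LAM y. t else LAM y. subst x s t)"
| "subst x s (t $ u) = subst x s t $ subst x s u"

text \<open>The side condition of \<open>abe_beta\<close> loses nothing, since \<open>abe_alpha\<close> and the congruence rules allow
  the bound variables of \<open>t\<close> to be renamed first.\<close>

inductive abe_eq :: "lam \<Rightarrow> lam \<Rightarrow> bool"  (infix \<open>=\<^sub>\<alpha>\<^sub>\<beta>\<^sub>\<eta>\<close> 50) where
  abe_alpha: "y \<notin> fv t \<union> bv t \<Longrightarrow> (LAM x. t) =\<^sub>\<alpha>\<^sub>\<beta>\<^sub>\<eta> (LAM y. subst x (LVar y) t)"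
| abe_beta:  "fv s \<inter> bv t = {} \<Longrightarrow> (LAM x. t) $ s =\<^sub>\<alpha>\<^sub>\<beta>\<^sub>\<eta> subst x s t"
| abe_eta:   "x \<notin> fv t \<Longrightarrow> (LAM x. t $ LVar x) =\<^sub>\<alpha>\<^sub>\<beta>\<^sub>\<eta> t"
| abe_refl:  "t =\<^sub>\<alpha>\<^sub>\<beta>\<^sub>\<eta> t"
| abe_sym:   "t =\<^sub>\<alpha>\<^sub>\<beta>\<^sub>\<eta> u \<Longrightarrow> u =\<^sub>\<alpha>\<^sub>\<beta>\<^sub>\<eta> t"
| abe_trans: "t =\<^sub>\<alpha>\<^sub>\<beta>\<^sub>\<eta> u \<Longrightarrow> u =\<^sub>\<alpha>\<^sub>\<beta>\<^sub>\<eta> v \<Longrightarrow> t =\<^sub>\<alpha>\<^sub>\<beta>\<^sub>\<eta> v"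
| abe_lam:   "t =\<^sub>\<alpha>\<^sub>\<beta>\<^sub>\<eta> u \<Longrightarrow> (LAM x. t) =\<^sub>\<alpha>\<^sub>\<beta>\<^sub>\<eta> (LAM x. u)"
| abe_app:   "t =\<^sub>\<alpha>\<^sub>\<beta>\<^sub>\<eta> t' \<Longrightarrow> u =\<^sub>\<alpha>\<^sub>\<beta>\<^sub>\<eta> u' \<Longrightarrow> t $ u =\<^sub>\<alpha>\<^sub>\<beta>\<^sub>\<eta> t' $ u'"


section \<open>Cedille terms and erasure\<close>

text \<open>Raw syntax. Term and type variables share the sort of names, so that the single constructor
  \<open>ILam\<close> serves for implicit abstraction over values and over types. In the types, a final
  \<open>V\<close> or \<open>T\<close> marks binding of (or application to) a value or a type; non-dependent arrows are
  the special cases with a vacuous variable.\<close>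

datatype knd =
    Star
  | KPiV name ty knd
  | KPiT name knd knd
and ty =
    TyVar name
  | TyAllV name ty ty
  | TyAllT name knd ty
  | TyPi name ty ty
  | TyIota name ty ty
  | TyEq tm tm
  | TyLamV name ty ty
  | TyLamT name knd ty
  | TyAppV ty tm
  | TyAppT ty ty
and tm =
    Var name
  | Lam name tm   (\<open>(\<open>open_block notation=\<open>binder lambda\<close>\<close>\<^bold>\<lambda>_./ _)\<close> [100, 10] 10)
  | App tm tm     (infixl \<open>\<bullet>\<close> 200)
  | ILam name tm  (\<open>(\<open>open_block notation=\<open>binder Lambda\<close>\<close>\<^bold>\<Lambda>_./ _)\<close> [100, 10] 10)
  | IApp tm tm    (infixl \<open>\<bullet>-\<close> 200)
  | TApp tm ty    (infixl \<open>\<cdot>\<close> 200)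
  | IPair tm tm   (\<open>\<^bold>[_,/ _\<^bold>]\<close>)
  | Proj1 tm      (\<open>_\<^bold>.1\<close> [300] 300)
  | Proj2 tm      (\<open>_\<^bold>.2\<close> [300] 300)
  | Beta          (\<open>\<beta>\<close>)
  | BetaT tm      (\<open>\<beta>\<^bold>{_\<^bold>}\<close>)
  | Rho tm tm     (\<open>\<rho> _ \<^bold>-/ _\<close> [100, 10] 10)

fun erase :: "tm \<Rightarrow> lam" where
  "erase (Var x) = LVar x"
| "erase (\<^bold>\<lambda>x. t) = (LAM x. erase t)"
| "erase (t \<bullet> t') = erase t $ erase t'"
| "erase (\<^bold>\<Lambda>x. t) = erase t"
| "erase (t \<bullet>- t') = erase t"
| "erase (t \<cdot> T) = erase t"
| "erase \<^bold>[t, t'\<^bold>] = erase t"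
| "erase (t\<^bold>.1) = erase t"
| "erase (t\<^bold>.2) = erase t"
| "erase \<beta> = (LAM ''x''. LVar ''x'')"
| "erase \<beta>\<^bold>{t\<^bold>} = erase t"
| "erase (\<rho> q \<^bold>- t) = erase t"


section \<open>Map for inductive lists\<close>

definition mkList :: tm where
  "mkList = (\<^bold>\<Lambda>''A''. \<^bold>\<lambda>''xs''. \<^bold>\<Lambda>''q''.
     \<^bold>[Var ''xs'', \<rho> (Var ''q'') \<^bold>- \<beta>\<^bold>{Var ''xs''\<^bold>}\<^bold>])"

definition mapCL :: tm where
  "mapCL = (\<^bold>\<Lambda>''A''. \<^bold>\<Lambda>''B''. \<^bold>\<lambda>''f''. \<^bold>\<lambda>''xs''. \<^bold>\<Lambda>''X''. \<^bold>\<lambda>''cN''. \<^bold>\<lambda>''cC''.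
     (Var ''xs'')\<^bold>.1\<^bold>.1 \<cdot> TyVar ''X'' \<bullet> Var ''cN''
       \<bullet> (\<^bold>\<lambda>''x''. Var ''cC'' \<bullet> (Var ''f'' \<bullet> Var ''x'')))"

definition mapPL :: tm where
  "mapPL = (\<^bold>\<Lambda>''A''. \<^bold>\<Lambda>''B''. \<^bold>\<lambda>''f''. \<^bold>\<lambda>''xs''. \<^bold>\<Lambda>''X''. \<^bold>\<Lambda>''P''. \<^bold>\<Lambda>''cN''. \<^bold>\<Lambda>''cC''.
     \<^bold>\<lambda>''pN''. \<^bold>\<lambda>''pC''.
     (Var ''xs'')\<^bold>.1\<^bold>.2 \<cdot> TyVar ''X'' \<cdot> TyVar ''P'' \<bullet>- Var ''cN''
       \<bullet>- (\<^bold>\<lambda>''x''. Var ''cC'' \<bullet> (Var ''f'' \<bullet> Var ''x''))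
       \<bullet> Var ''pN''
       \<bullet> (\<^bold>\<Lambda>''xsC''. \<^bold>\<lambda>''x''. Var ''pC'' \<bullet>- Var ''xsC'' \<bullet> (Var ''f'' \<bullet> Var ''x'')))"

text \<open>The proof term \<open>mapRL\<close> of
  \<open>\<forall>A. \<forall>B. \<Pi>f : A \<rightarrow> B. \<Pi>xs : List A. ListR B (mapCL A B f xs)\<close> has no prescribed definition, so it
  is a parameter.\<close>

definition mapL :: "tm \<Rightarrow> tm" where
  "mapL mapRL = (\<^bold>\<Lambda>''A''. \<^bold>\<Lambda>''B''. \<^bold>\<lambda>''f''. \<^bold>\<lambda>''xs''.
     mkList \<cdot> TyVar ''B''
       \<bullet> \<^bold>[mapCL \<cdot> TyVar ''A'' \<cdot> TyVar ''B'' \<bullet> Var ''f'' \<bullet> Var ''xs'',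
          mapPL \<cdot> TyVar ''A'' \<cdot> TyVar ''B'' \<bullet> Var ''f'' \<bullet> Var ''xs''\<^bold>]
       \<bullet>- (mapRL \<cdot> TyVar ''A'' \<cdot> TyVar ''B'' \<bullet> Var ''f'' \<bullet> Var ''xs''))"

end

theory Submission
  imports Defs
begin

text \<open>Erasure discards \<open>mapPL\<close> (second component of a pair) and
  \<open>mapRL\<close> (an implicit argument) and turns \<open>mkList\<close> into an identity, so
  what remains is \<open>mapCL\<close> under an abstraction over the list. With \<open>f\<close> the
  identity, \<open>mapCL\<close> sends a variable \<open>xs\<close> to the function taking
  \<open>cN\<close> and \<open>cC\<close> to \<open>xs\<close> applied to \<open>cN\<close> and to
  the eta-expansion of \<open>cC\<close>; eta then recovers \<open>xs\<close>
  (\<open>erase_mapCL_id_app\<close>). No induction on lists is involved, and \<open>mapRL\<close>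
  can be arbitrary.\<close>

declare abe_trans [trans]

lemma abe_beta_eq:
  "fv s \<inter> bv t = {} \<Longrightarrow> subst x s t = u \<Longrightarrow> (LAM x. t) $ s =\<^sub>\<alpha>\<^sub>\<beta>\<^sub>\<eta> u"
  using abe_beta by blast

lemma abe_id_app: "(LAM x. LVar x) $ s =\<^sub>\<alpha>\<^sub>\<beta>\<^sub>\<eta> s"
  by (rule abe_beta_eq) simp_all

text \<open>Names are concrete, so alpha must be invoked explicitly; \<open>abe_alpha\<close> wants
  a fresh name, hence the case split.\<close>

lemma abe_id_rename: "(LAM y. LVar y) =\<^sub>\<alpha>\<^sub>\<beta>\<^sub>\<eta> (LAM x. LVar x)"
proof (cases "x = y")
  case True
  then show ?thesis by (simp add: abe_refl)
next
  case False
  then show ?thesis using abe_alpha [of x "LVar y" y] by simp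
qed

text \<open>Beta under the binder exposes an eta-redex. This is the shape of the cons argument of
  \<open>mapCL\<close> once \<open>f\<close> is the identity.\<close>

lemma abe_eta_id:
  assumes "x \<notin> fv t"
  shows "(LAM x. t $ ((LAM y. LVar y) $ LVar x)) =\<^sub>\<alpha>\<^sub>\<beta>\<^sub>\<eta> t"
  using abe_trans [OF abe_lam [OF abe_app [OF abe_refl abe_id_app]] abe_eta [OF assms]] .

lemma abe_eta2:
  assumes "x \<notin> fv t" "y \<notin> fv t" "x \<noteq> y"
  shows "(LAM x. LAM y. t $ LVar x $ LVar y) =\<^sub>\<alpha>\<^sub>\<beta>\<^sub>\<eta> t"
proof -
  have "(LAM y. t $ LVar x $ LVar y) =\<^sub>\<alpha>\<^sub>\<beta>\<^sub>\<eta> t $ LVar x"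
    using assms by (intro abe_eta) simp
  then show ?thesis
    using assms by (blast intro: abe_trans abe_lam abe_eta)
qed

text \<open>Two beta steps supply \<open>f\<close> and \<open>xs\<close>; eta then simplifies the
  cons argument and finally removes both outer abstractions.\<close>

lemma erase_mapCL_id_app:
  "erase mapCL $ (LAM ''x''. LVar ''x'') $ LVar ''xs'' =\<^sub>\<alpha>\<^sub>\<beta>\<^sub>\<eta> LVar ''xs''"
proof -
  let ?id = "LAM ''x''. LVar ''x''"
  let ?g = "LAM ''x''. LVar ''cC'' $ (?id $ LVar ''x'')"
  let ?body = "LAM ''cN''. LAM ''cC''. LVar ''xs'' $ LVar ''cN'' $ ?g"
  have "erase mapCL $ ?id =\<^sub>\<alpha>\<^sub>\<beta>\<^sub>\<eta> (LAM ''xs''. ?body)"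
    unfolding mapCL_def erase.simps by (rule abe_beta_eq) simp_all
  then have "erase mapCL $ ?id $ LVar ''xs'' =\<^sub>\<alpha>\<^sub>\<beta>\<^sub>\<eta> (LAM ''xs''. ?body) $ LVar ''xs''"
    by (intro abe_app abe_refl)
  also have "\<dots> =\<^sub>\<alpha>\<^sub>\<beta>\<^sub>\<eta> ?body"
    by (rule abe_beta_eq) simp_all
  also have "?body =\<^sub>\<alpha>\<^sub>\<beta>\<^sub>\<eta>
      (LAM ''cN''. LAM ''cC''. LVar ''xs'' $ LVar ''cN'' $ LVar ''cC'')"
    by (intro abe_lam abe_app abe_refl abe_eta_id) simp
  also have "\<dots> =\<^sub>\<alpha>\<^sub>\<beta>\<^sub>\<eta> LVar ''xs''"
    by (rule abe_eta2) simp_all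
  finally show ?thesis .
qed

theorem theorem5p4:
  fixes mapRL :: tm
  shows "erase (mapL mapRL) $ (LAM ''x''. LVar ''x'') =\<^sub>\<alpha>\<^sub>\<beta>\<^sub>\<eta> (LAM ''x''. LVar ''x'')"
proof -
  let ?id = "LAM ''x''. LVar ''x''"
  have "erase (mapL mapRL) $ ?id =\<^sub>\<alpha>\<^sub>\<beta>\<^sub>\<eta>
      (LAM ''xs''. erase mkList $ (erase mapCL $ ?id $ LVar ''xs''))"
    unfolding mapL_def erase.simps
    \<comment> \<open>Unfolding shows that substituting for \<open>f\<close> leaves both erased
      constants unchanged, as \<open>f\<close> is not free in them.\<close>
    by (rule abe_beta_eq) (simp_all add: mapCL_def mkList_def)
  also have "\<dots> =\<^sub>\<alpha>\<^sub>\<beta>\<^sub>\<eta> (LAM ''xs''. erase mkList $ LVar ''xs'')"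
    by (intro abe_lam abe_app abe_refl erase_mapCL_id_app)
  also have "\<dots> =\<^sub>\<alpha>\<^sub>\<beta>\<^sub>\<eta> (LAM ''xs''. LVar ''xs'')"
    unfolding mkList_def erase.simps by (intro abe_lam abe_id_app)
  also have "\<dots> =\<^sub>\<alpha>\<^sub>\<beta>\<^sub>\<eta> ?id"
    by (rule abe_id_rename)
  finally show ?thesis .
qed

end
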